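(* Up to isomorphism, there is precisely one symmetric association scheme $\mathcal{A} = (X, \{R_0, \dots, R_5\})$ with $R_0 = \mathrm{Id}_X$ whose intersection numbers, written as matrices $(p^h_{ij})_{i,j=0}^5$ for $h = 0,\dots,5$ (rows indexed by $i$, columns by $j$), are: $(p^0_{ij}) = \mathrm{diag}(1, 6, 4, 4, 12, 18)$; $(p^1_{ij})$ has rows $(0,1,0,0,0,0)$, $(1,0,2,0,0,3)$, $(0,2,0,0,2,0)$, $(0,0,0,0,4,0)$, $(0,0,2,4,0,6)$, $(0,3,0,0,6,9)$; $(p^2_{ij})$ has rows $(0,0,1,0,0,0)$, $(0,3,0,0,3,0)$, $(1,0,1,2,0,0)$, $(0,0,2,2,0,0)$, $(0,3,0,0,9,0)$, $(0,0,0,0,0,18)$; $(p^3_{ij})$ has rows $(0,0,0,1,0,0)$, $(0,0,0,0,6,0)$, $(0,0,2,2,0,0)$, $(1,0,2,1,0,0)$, $(0,6,0,0,6,0)$, $(0,0,0,0,0,18)$; $(p^4_{ij})$ has rows $(0,0,0,0,1,0)$, $(0,0,1,2,0,3)$, $(0,1,0,0,3,0)$, $(0,2,0,0,2,0)$, $(1,0,3,2,0,6)$, $(0,3,0,0,6,9)$; $(p^5_{ij})$ has rows $(0,0,0,0,0,1)$, $(0,1,0,0,2,3)$, $(0,0,0,0,0,4)$, $(0,0,0,0,0,4)$, $(0,2,0,0,4,6)$, $(1,3,4,4,6,0)$.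
   Context: A symmetric association scheme is a pair $(X, \{R_i \mid i \in \mathcal{I}\})$ where $X$ is a finite set and the $R_i$ are nonempty symmetric binary relations on $X$ partitioning $X^2$, with $R_0$ the identity relation, such that for all $h,i,j$ there is a number $p^h_{ij}$ (intersection number) with the property that for every $(x,y) \in R_h$ there are exactly $p^h_{ij}$ vertices $z$ with $(x,z) \in R_i$ and $(z,y) \in R_j$. Two schemes $(X,\mathcal{R})$, $(X',\mathcal{R}')$ are isomorphic if there are bijections $\phi: X \to X'$ and $\psi: \mathcal{R} \to \mathcal{R}'$ such that $(x,y) \in R$ iff $(\phi(x),\phi(y)) \in \psi(R)$ for all $x,y \in X$, $R \in \mathcal{R}$. (Such a scheme has $45$ vertices.) *)

theory Defs
  imports Main "HOL-Library.Disjoint_Sets"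
begin

definition intersection_numbers ::
  "'a set \<Rightarrow> 'i set \<Rightarrow> ('i \<Rightarrow> ('a \<times> 'a) set) \<Rightarrow> ('i \<Rightarrow> 'i \<Rightarrow> 'i \<Rightarrow> nat) \<Rightarrow> bool"
  where
  "intersection_numbers X I R p \<longleftrightarrow>
     (\<forall>h\<in>I. \<forall>i\<in>I. \<forall>j\<in>I. \<forall>(x, y)\<in>R h.
        card {z \<in> X. (x, z) \<in> R i \<and> (z, y) \<in> R j} = p h i j)"

text \<open>
  Disjointness is required of the indexed family, so distinct indices in \<open>I\<close>
  carry distinct relations; values of \<open>R\<close> outside \<open>I\<close> are irrelevant. Since the
  relations are nonempty, the intersection numbers are unique on \<open>I\<close>.
\<close>

definition symmetric_association_scheme ::
  "'a set \<Rightarrow> 'i::zero set \<Rightarrow> ('i \<Rightarrow> ('a \<times> 'a) set) \<Rightarrow> bool"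
  where
  "symmetric_association_scheme X I R \<longleftrightarrow>
     finite X \<and>
     (\<forall>i\<in>I. R i \<noteq> {} \<and> sym (R i)) \<and>
     disjoint_family_on R I \<and>
     (\<Union>i\<in>I. R i) = X \<times> X \<and>
     0 \<in> I \<and> R 0 = Id_on X \<and>
     (\<exists>p. intersection_numbers X I R p)"

text \<open>
  An isomorphism may permute the relations: it refers to the sets of relations
  and not to their indexing.
\<close>

definition isomorphic_schemes ::
  "'a set \<Rightarrow> ('a \<times> 'a) set set \<Rightarrow> 'b set \<Rightarrow> ('b \<times> 'b) set set \<Rightarrow> bool"
  where
  "isomorphic_schemes X \<R> X' \<R>' \<longleftrightarrow>
     (\<exists>\<phi> \<psi>. bij_betw \<phi> X X' \<and> bij_betw \<psi> \<R> \<R>' \<and>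
        (\<forall>x\<in>X. \<forall>y\<in>X. \<forall>Q\<in>\<R>. (x, y) \<in> Q \<longleftrightarrow> (\<phi> x, \<phi> y) \<in> \<psi> Q))"

text \<open>The \<open>h\<close>-th entry is the matrix with \<open>(i, j)\<close> entry $p^h_{ij}$, given by rows.\<close>

definition scheme45_matrices :: "nat list list list" where
  "scheme45_matrices =
   [[[1, 0, 0, 0, 0, 0],
     [0, 6, 0, 0, 0, 0],
     [0, 0, 4, 0, 0, 0],
     [0, 0, 0, 4, 0, 0],
     [0, 0, 0, 0, 12, 0],
     [0, 0, 0, 0, 0, 18]],

    [[0, 1, 0, 0, 0, 0],
     [1, 0, 2, 0, 0, 3],
     [0, 2, 0, 0, 2, 0],
     [0, 0, 0, 0, 4, 0],
     [0, 0, 2, 4, 0, 6],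
     [0, 3, 0, 0, 6, 9]],

    [[0, 0, 1, 0, 0, 0],
     [0, 3, 0, 0, 3, 0],
     [1, 0, 1, 2, 0, 0],
     [0, 0, 2, 2, 0, 0],
     [0, 3, 0, 0, 9, 0],
     [0, 0, 0, 0, 0, 18]],

    [[0, 0, 0, 1, 0, 0],
     [0, 0, 0, 0, 6, 0],
     [0, 0, 2, 2, 0, 0],
     [1, 0, 2, 1, 0, 0],
     [0, 6, 0, 0, 6, 0],
     [0, 0, 0, 0, 0, 18]],

    [[0, 0, 0, 0, 1, 0],
     [0, 0, 1, 2, 0, 3],
     [0, 1, 0, 0, 3, 0],
     [0, 2, 0, 0, 2, 0],
     [1, 0, 3, 2, 0, 6],
     [0, 3, 0, 0, 6, 9]],

    [[0, 0, 0, 0, 0, 1],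
     [0, 1, 0, 0, 2, 3],
     [0, 0, 0, 0, 0, 4],
     [0, 0, 0, 0, 0, 4],
     [0, 2, 0, 0, 4, 6],
     [1, 3, 4, 4, 6, 0]]]"

definition scheme45 :: "'a set \<Rightarrow> (nat \<Rightarrow> ('a \<times> 'a) set) \<Rightarrow> bool" where
  "scheme45 X R \<longleftrightarrow>
     symmetric_association_scheme X {0..5} R \<and>
     intersection_numbers X {0..5} R (\<lambda>h i j. scheme45_matrices ! h ! i ! j)"

end

theory Submission imports Defs "HOL-Library.Numeral_Type" "HOL-Library.Countable" begin

text \<open>
  The relations \<open>R 0 \<union> R 2 \<union> R 3\<close> form an equivalence with five blocks of nine points, and on each
  block \<open>R 2\<close> is the 3 by 3 lattice graph. The blocks form a pentagon, two blocks at distance 2 being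
  joined entirely by \<open>R 5\<close>. Between neighbouring blocks the \<open>R 1\<close>-neighbourhood of a point is a line of
  the lattice graph, and two such neighbourhoods in the same block are equal or disjoint. Hence \<open>R 1\<close>
  matches a parallel class of lines of one block with a parallel class of the next one, and the two
  neighbours of a block use its two different parallel classes. Labelling the three lines matched
  along each edge of the pentagon identifies \<open>X\<close> with \<open>5 \<times> 3 \<times> 3\<close>, where \<open>(i, a, b)\<close> is the point of
  block \<open>i\<close> on the lines \<open>a\<close> and \<open>b\<close> shared with the blocks \<open>i - 1\<close> and \<open>i + 1\<close>.
  Conversely, rotations of the pentagon and permutations of the labels are automorphisms of this
  model, so its intersection numbers need to be counted only for pairs of points of which one is
  \<open>(0, 0, 0)\<close>.
\<close>

section \<open>Schemes as colourings of pairs of points\<close>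

abbreviation P45 :: "nat \<Rightarrow> nat \<Rightarrow> nat \<Rightarrow> nat" where
  "P45 h i j \<equiv> scheme45_matrices ! h ! i ! j"

text \<open>One function gives the index of the relation containing each pair, so that the relations
  form a partition by construction and the counts are stated for all pairs at once.\<close>

locale coloring45 =
  fixes X :: "'a set" and col :: "'a \<Rightarrow> 'a \<Rightarrow> nat"
  assumes finite_X: "finite X"
    and X_nonempty: "X \<noteq> {}"
    and col_le: "\<And>x y. x \<in> X \<Longrightarrow> y \<in> X \<Longrightarrow> col x y \<le> 5"
    and col_sym: "\<And>x y. x \<in> X \<Longrightarrow> y \<in> X \<Longrightarrow> col x y = col y x"
    and col_eq_0_iff: "\<And>x y. x \<in> X \<Longrightarrow> y \<in> X \<Longrightarrow> col x y = 0 \<longleftrightarrow> x = y"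
    and card_col: "\<And>x y i j. x \<in> X \<Longrightarrow> y \<in> X \<Longrightarrow> i \<le> 5 \<Longrightarrow> j \<le> 5 \<Longrightarrow>
      card {z \<in> X. col x z = i \<and> col z y = j} = P45 (col x y) i j"

definition color_rel :: "'a set \<Rightarrow> ('a \<Rightarrow> 'a \<Rightarrow> nat) \<Rightarrow> nat \<Rightarrow> ('a \<times> 'a) set" where
  "color_rel X col i = {(x, y) \<in> X \<times> X. col x y = i}"

lemma le5_cases: "(i::nat) \<le> 5 \<longleftrightarrow> i = 0 \<or> i = 1 \<or> i = 2 \<or> i = 3 \<or> i = 4 \<or> i = 5"
  by auto

lemma P45_diag_pos: "i \<le> 5 \<Longrightarrow> P45 0 i i > 0"
  unfolding le5_cases by (elim disjE) (simp_all add: scheme45_matrices_def)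

context coloring45 begin

lemma card_nonzero_imp_ex:
  assumes "x \<in> X" "y \<in> X" "i \<le> 5" "j \<le> 5" "P45 (col x y) i j \<noteq> 0"
  shows "\<exists>z\<in>X. col x z = i \<and> col z y = j"
proof -
  have "{z \<in> X. col x z = i \<and> col z y = j} \<noteq> {}"
    using card_col[OF assms(1-4)] assms(5) by force
  then show ?thesis by blast
qed

lemma scheme45_color_rel: "scheme45 X (color_rel X col)"
proof -
  have ne: "color_rel X col i \<noteq> {}" if "i \<le> 5" for i
  proof -
    have pos: "P45 0 i i \<noteq> 0" using P45_diag_pos[OF that] by simp
    obtain x where "x \<in> X" using X_nonempty by blast
    moreover have "col x x = 0" using col_eq_0_iff \<open>x \<in> X\<close> by blast
    ultimately obtain z where "z \<in> X" "col x z = i"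
      using card_nonzero_imp_ex[of x x i i] pos \<open>i \<le> 5\<close> by auto
    then show ?thesis using \<open>x \<in> X\<close> by (auto simp: color_rel_def)
  qed
  have nums: "intersection_numbers X {0..5} (color_rel X col) P45"
    unfolding intersection_numbers_def
  proof (intro ballI, clarify)
    fix h i j x y
    assume *: "h \<in> {0..5::nat}" "i \<in> {0..5::nat}" "j \<in> {0..5::nat}" "(x, y) \<in> color_rel X col h"
    then have "{z \<in> X. (x, z) \<in> color_rel X col i \<and> (z, y) \<in> color_rel X col j} =
        {z \<in> X. col x z = i \<and> col z y = j}"
      by (auto simp: color_rel_def)
    then show "card {z \<in> X. (x, z) \<in> color_rel X col i \<and> (z, y) \<in> color_rel X col j} = P45 h i j"
      using card_col[of x y i j] * by (auto simp: color_rel_def)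
  qed
  have "symmetric_association_scheme X {0..5} (color_rel X col)"
    unfolding symmetric_association_scheme_def
  proof (intro conjI ballI)
    show "sym (color_rel X col i)" for i
      using col_sym by (auto simp: sym_def color_rel_def)
    show "disjoint_family_on (color_rel X col) {0..5}"
      by (auto simp: disjoint_family_on_def color_rel_def)
    show "(\<Union>i\<in>{0..5}. color_rel X col i) = X \<times> X"
      using col_le by (auto simp: color_rel_def)
    show "color_rel X col 0 = Id_on X"
      using col_eq_0_iff by (auto simp: color_rel_def Id_on_def)
  qed (use finite_X ne nums in auto)
  with nums show ?thesis by (simp add: scheme45_def)
qed

text \<open>Transport of structure along an injection; it carries the model on a finite type over to
  a set of natural numbers.\<close>

lemma coloring45_image:
  assumes "inj_on f X"
  shows "coloring45 (f ` X) (\<lambda>u v. col (inv_into X f u) (inv_into X f v))"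
proof unfold_locales
  fix u v i j assume "u \<in> f ` X" "v \<in> f ` X" and ij: "i \<le> (5::nat)" "j \<le> (5::nat)"
  then obtain x y where xy: "x \<in> X" "y \<in> X" "u = f x" "v = f y" by blast
  let ?g = "inv_into X f"
  have "{z \<in> f ` X. col (?g u) (?g z) = i \<and> col (?g z) (?g v) = j} =
      f ` {z \<in> X. col x z = i \<and> col z y = j}"
    using assms xy by (auto simp: inv_into_f_f)
  moreover have "inj_on f {z \<in> X. col x z = i \<and> col z y = j}"
    using assms by (rule inj_on_subset) auto
  ultimately show "card {z \<in> f ` X. col (?g u) (?g z) = i \<and> col (?g z) (?g v) = j} =
      P45 (col (?g u) (?g v)) i j"
    using assms xy ij card_col by (simp add: card_image inv_into_f_f)
qed (use finite_X X_nonempty col_le col_sym col_eq_0_iff assms in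
  \<open>auto simp: inv_into_f_f inj_on_eq_iff\<close>)

end

text \<open>The relations cover \<open>X \<times> X\<close> and are disjoint, so the description
  defining \<open>col\<close> denotes a unique index for every pair of points of
  \<open>X\<close>.\<close>

lemma scheme45_obtain_coloring:
  assumes "scheme45 X R"
  obtains col where "coloring45 X col" "\<And>i. i \<le> 5 \<Longrightarrow> R i = color_rel X col i"
proof -
  have fin: "finite X" and ne: "\<And>i. i \<le> 5 \<Longrightarrow> R i \<noteq> {}"
    and sym: "\<And>i. i \<le> 5 \<Longrightarrow> sym (R i)"
    and disj: "disjoint_family_on R {0..5}" and un: "(\<Union>i\<in>{0..5}. R i) = X \<times> X"
    and R0: "R 0 = Id_on X" and nums: "intersection_numbers X {0..5} R P45"
    using assms by (auto simp: scheme45_def symmetric_association_scheme_def)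
  define col where "col x y = (THE i. i \<le> 5 \<and> (x, y) \<in> R i)" for x y
  have uniq: "i = j" if "i \<le> 5" "j \<le> 5" "(x, y) \<in> R i" "(x, y) \<in> R j" for i j x y
    using disj that by (fastforce simp: disjoint_family_on_def)
  have col_eq: "col x y = i" if "i \<le> 5" "(x, y) \<in> R i" for i x y
    unfolding col_def using that uniq by blast
  have col: "col x y \<le> 5 \<and> (x, y) \<in> R (col x y)" if "x \<in> X" "y \<in> X" for x y
  proof -
    have "(x, y) \<in> (\<Union>i\<in>{0..5}. R i)" unfolding un using that by blast
    then obtain i where "i \<le> 5" "(x, y) \<in> R i" by auto
    then show ?thesis using col_eq by simp
  qed
  have R_sub: "R i \<subseteq> X \<times> X" if "i \<le> 5" for i
  proof -
    have "R i \<subseteq> (\<Union>i\<in>{0..5}. R i)" using that by auto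
    then show ?thesis unfolding un .
  qed
  have R_iff: "(x, y) \<in> R i \<longleftrightarrow> col x y = i" if "i \<le> 5" "x \<in> X" "y \<in> X" for i x y
    using col col_eq that by blast
  have R_eq: "R i = color_rel X col i" if "i \<le> 5" for i
    using R_sub[OF that] R_iff[OF that] by (auto simp: color_rel_def)
  have "coloring45 X col"
  proof
    show "X \<noteq> {}" using ne[of 0] R0 by auto
    show "col x y = col y x" if "x \<in> X" "y \<in> X" for x y
      using col[OF that] sym col_eq[of "col x y" y x] by (auto simp: sym_def)
    show "col x y = 0 \<longleftrightarrow> x = y" if "x \<in> X" "y \<in> X" for x y
      using R_iff[of 0 x y] R0 that by (auto simp: Id_on_def)
    show "card {z \<in> X. col x z = i \<and> col z y = j} = P45 (col x y) i j"
      if *: "x \<in> X" "y \<in> X" "i \<le> 5" "j \<le> 5" for x y i j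
    proof -
      have "{z \<in> X. col x z = i \<and> col z y = j} = {z \<in> X. (x, z) \<in> R i \<and> (z, y) \<in> R j}"
        using R_iff * by auto
      moreover have "card {z \<in> X. (x, z) \<in> R i \<and> (z, y) \<in> R j} = P45 (col x y) i j"
        using nums col[OF *(1,2)] * unfolding intersection_numbers_def by fastforce
      ultimately show ?thesis by simp
    qed
  qed (use fin col in auto)
  then show ?thesis using that R_eq by blast
qed

section \<open>The model on \<open>5 \<times> 3 \<times> 3\<close> and its intersection
  numbers\<close>

definition shape :: "5 \<times> 3 \<times> 3 \<Rightarrow> 5 \<times> 3 \<times> 3 \<Rightarrow> nat" where
  "shape = (\<lambda>(i, a, b) (j, c, d).
     if i = j then (if a = c then (if b = d then 0 else 2) else if b = d then 2 else 3)
     else if j = i + 1 then (if b = c then 1 else 4)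
     else if i = j + 1 then (if d = a then 1 else 4)
     else 5)"

definition model_points :: "(5 \<times> 3 \<times> 3) list" where
  "model_points = List.product [0, 1, 2, 3, 4] (List.product [0, 1, 2] [0, 1, 2])"

lemma exhaust_mod5: "(x :: 5) = 0 \<or> x = 1 \<or> x = 2 \<or> x = 3 \<or> x = 4"
proof (induct x)
  case (of_int z)
  then have "z = 0 \<or> z = 1 \<or> z = 2 \<or> z = 3 \<or> z = 4" by auto
  then show ?case by auto
qed

lemma exhaust_mod3: "(x :: 3) = 0 \<or> x = 1 \<or> x = 2"
proof (induct x)
  case (of_int z)
  then have "z = 0 \<or> z = 1 \<or> z = 2" by auto
  then show ?case by auto
qed

lemma set_model_points: "set model_points = UNIV"
proof -
  have mod5: "set [0, 1, 2, 3, 4] = (UNIV :: 5 set)" using exhaust_mod5 by auto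
  have mod3: "set [0, 1, 2] = (UNIV :: 3 set)" using exhaust_mod3 by auto
  show ?thesis unfolding model_points_def set_product mod5 mod3 by simp
qed

lemma distinct_model_points: "distinct model_points"
  unfolding model_points_def by (intro distinct_product) simp_all

text \<open>One evaluation of the list of colour pairs serves all 36 entries of a matrix.\<close>

definition tally :: "(nat \<times> nat) list \<Rightarrow> nat list list" where
  "tally ps = map (\<lambda>i. map (\<lambda>j. length (filter (\<lambda>p. p = (i, j)) ps)) [0..<6]) [0..<6]"

text \<open>A finite computation over 20 target points, the normal forms that remain after applying
  automorphisms.\<close>

lemma tally_origin:
  assumes "c \<in> {0, 1}" "d \<in> {0, 1}"
  shows "tally (map (\<lambda>z. (shape (0, 0, 0) z, shape z (j, c, d))) model_points) =
    scheme45_matrices ! shape (0, 0, 0) (j, c, d)"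
  using exhaust_mod5[of j] assms
  by (elim disjE insertE emptyE)
    (simp_all add: model_points_def shape_def tally_def upt_rec scheme45_matrices_def)

lemma card_shape_origin:
  assumes "c \<in> {0, 1}" "d \<in> {0, 1}" "p \<le> 5" "q \<le> 5"
  shows "card {z. shape (0, 0, 0) z = p \<and> shape z (j, c, d) = q} =
    P45 (shape (0, 0, 0) (j, c, d)) p q"
proof -
  let ?f = "\<lambda>z. (shape (0, 0, 0) z, shape z (j, c, d))"
  have "{z. shape (0, 0, 0) z = p \<and> shape z (j, c, d) = q} =
      set (filter (\<lambda>z. ?f z = (p, q)) model_points)"
    by (auto simp: set_model_points)
  then have "card {z. shape (0, 0, 0) z = p \<and> shape z (j, c, d) = q} =
      length (filter (\<lambda>z. ?f z = (p, q)) model_points)"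
    using distinct_card[OF distinct_filter[OF distinct_model_points]] by metis
  also have "\<dots> = tally (map ?f model_points) ! p ! q"
    using assms(3,4) by (simp add: tally_def filter_map o_def)
  finally show ?thesis using tally_origin[OF assms(1,2)] by simp
qed

text \<open>\<open>\<pi> i\<close> permutes the labels on the pentagon edge between blocks
  \<open>i - 1\<close> and \<open>i\<close>. The second label of block \<open>i\<close> belongs to
  the next edge, hence \<open>\<pi> (i + 1)\<close>. Edges are indexed as before the rotation by
  \<open>k\<close>.\<close>

definition relabel :: "5 \<Rightarrow> (5 \<Rightarrow> 3 \<Rightarrow> 3) \<Rightarrow> 5 \<times> 3 \<times> 3 \<Rightarrow> 5 \<times> 3 \<times> 3" where
  "relabel k \<pi> = (\<lambda>(i, a, b). (i - k, \<pi> i a, \<pi> (i + 1) b))"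

text \<open>\<open>shape\<close> only tests whether two labels on the same edge are equal and how
  blocks lie relative to each other.\<close>

lemma shape_relabel:
  assumes "\<forall>i. inj (\<pi> i)"
  shows "shape (relabel k \<pi> x) (relabel k \<pi> y) = shape x y"
proof -
  obtain i a b j c d where xy: "x = (i, a, b)" "y = (j, c, d)" by (metis prod.exhaust)
  have "j - k = i - k + 1 \<longleftrightarrow> j = i + 1" "i - k = j - k + 1 \<longleftrightarrow> i = j + 1"
    by (simp_all add: algebra_simps)
  then show ?thesis
    using assms by (auto simp: xy shape_def relabel_def inj_eq)
qed

lemma bij_relabel:
  assumes "\<forall>i. inj (\<pi> i)"
  shows "bij (relabel k \<pi>)"
proof -
  have "inj (relabel k \<pi>)"
    using assms by (auto simp: relabel_def inj_def)
  then show ?thesis by (simp add: bij_def finite_UNIV_inj_surj)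
qed

lemma ex_inj_two_points: "\<exists>f :: 3 \<Rightarrow> 3. inj f \<and> f a = 0 \<and> f b \<in> {0, 1}"
proof (cases "a = b")
  case True
  have "inj (\<lambda>x. x - a)" by (simp add: inj_def)
  then show ?thesis using True by (intro exI[of _ "\<lambda>x. x - a"]) simp
next
  case False
  \<comment> \<open>An affine map of the field of three elements: a nonzero element squares to 1, so
    \<open>a\<close> goes to 0 and \<open>b\<close> to 1.\<close>
  define f :: "3 \<Rightarrow> 3" where "f x = (x - a) * (b - a)" for x
  have sq: "(b - a) * (b - a) = 1" using False exhaust_mod3[of "b - a"] by auto
  have "inj f"
    by (rule inj_on_inverseI[of _ "\<lambda>x. x * (b - a) + a"]) (simp add: f_def mult.assoc sq)
  then show ?thesis using sq by (intro exI[of _ f]) (simp add: f_def)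
qed

lemma coloring45_shape: "coloring45 UNIV shape"
proof
  show "shape x y \<le> 5" for x y
    by (cases x; cases y) (simp add: shape_def)
  show "shape x y = shape y x" for x y
  proof -
    \<comment> \<open>The two cases for neighbouring blocks exclude each other, so their order in
      \<open>shape\<close> does not break symmetry.\<close>
    have "(i :: 5) \<noteq> i + 1 + 1" for i by simp
    then show ?thesis by (cases x; cases y) (auto simp: shape_def)
  qed
  show "shape x y = 0 \<longleftrightarrow> x = y" for x y
    by (cases x; cases y) (simp add: shape_def)
  show "card {z \<in> UNIV. shape x z = p \<and> shape z y = q} = P45 (shape x y) p q"
    if "p \<le> 5" "q \<le> 5" for x y p q
  proof -
    obtain i a b j c d where xy: "x = (i, a, b)" "y = (j, c, d)" by (metis prod.exhaust)
    \<comment> \<open>Each edge gets one permutation that serves both points. The first point has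
      labels only on the edges \<open>i\<close> and \<open>i + 1\<close>; \<open>b\<close> is a
      default value on all others, and likewise \<open>d\<close> for the second point.\<close>
    have "\<exists>\<pi>. \<forall>k. inj (\<pi> k) \<and> \<pi> k (if k = i then a else b) = (0::3) \<and>
        \<pi> k (if k = j then c else d) \<in> {0, 1::3}"
      using ex_inj_two_points by (intro choice) blast
    then obtain \<pi> :: "5 \<Rightarrow> 3 \<Rightarrow> 3" where inj: "\<forall>k. inj (\<pi> k)"
      and \<pi>x: "\<And>k. \<pi> k (if k = i then a else b) = 0"
      and \<pi>y: "\<And>k. \<pi> k (if k = j then c else d) \<in> {0, 1}" by blast
    let ?r = "relabel i \<pi>"
    have x: "?r x = (0, 0, 0)" using \<pi>x[of i] \<pi>x[of "i + 1"] by (simp add: xy relabel_def)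
    have y: "?r y = (j - i, \<pi> j c, \<pi> (j + 1) d)" by (simp add: xy relabel_def)
    have cd: "\<pi> j c \<in> {0, 1}" "\<pi> (j + 1) d \<in> {0, 1}"
      using \<pi>y[of j] \<pi>y[of "j + 1"] by simp_all
    have iff: "shape x z = p \<and> shape z y = q \<longleftrightarrow> shape (?r x) (?r z) = p \<and> shape (?r z) (?r y) = q" for z
      unfolding shape_relabel[OF inj] ..
    have img: "?r ` {z. shape x z = p \<and> shape z y = q} =
        {z. shape (?r x) z = p \<and> shape z (?r y) = q}"
      using surj_image_vimage_eq[OF bij_is_surj[OF bij_relabel[OF inj, of i]],
        of "{z. shape (?r x) z = p \<and> shape z (?r y) = q}"]
      unfolding iff vimage_Collect_eq .
    have inj_r: "inj_on ?r {z. shape x z = p \<and> shape z y = q}"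
      using bij_is_inj[OF bij_relabel[OF inj]] by (rule inj_on_subset) simp
    have "card {z. shape x z = p \<and> shape z y = q} =
        card {z. shape (?r x) z = p \<and> shape z (?r y) = q}"
      using card_image[OF inj_r] unfolding img by (rule sym)
    also have "\<dots> = P45 (shape (?r x) (?r y)) p q"
      unfolding x y by (rule card_shape_origin[OF cd that])
    finally show ?thesis unfolding shape_relabel[OF inj] by simp
  qed
qed auto

section \<open>The blocks and their pentagon\<close>

text \<open>The distance in the pentagon between the blocks of two points whose colour is
  \<open>c\<close>.\<close>

definition kind :: "nat \<Rightarrow> nat" where
  "kind c = (if c \<in> {0, 2, 3} then 0 else if c \<in> {1, 4} then 1 else 2)"

text \<open>Checked on all 216 table entries. The first fact makes kind 0 compatible with all kinds;
  the others reflect that a pentagon has no triangle and no three pairwise nonadjacent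
  vertices.\<close>

lemma kind_P45:
  assumes "h \<le> 5" "i \<le> 5" "j \<le> 5" "P45 h i j \<noteq> 0"
  shows "kind h = 0 \<Longrightarrow> kind i = kind j"
    and "\<not> (kind h = 1 \<and> kind i = 1 \<and> kind j = 1)"
    and "\<not> (kind h = 2 \<and> kind i = 2 \<and> kind j = 2)"
proof -
  have "\<forall>h\<in>set [0..<6]. \<forall>i\<in>set [0..<6]. \<forall>j\<in>set [0..<6]. P45 h i j \<noteq> 0 \<longrightarrow>
      (kind h = 0 \<longrightarrow> kind i = kind j) \<and> \<not> (kind h = 1 \<and> kind i = 1 \<and> kind j = 1) \<and>
      \<not> (kind h = 2 \<and> kind i = 2 \<and> kind j = 2)"
    by code_simp
  moreover have "h \<in> set [0..<6]" "i \<in> set [0..<6]" "j \<in> set [0..<6]"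
    using assms(1-3) by auto
  ultimately show "kind h = 0 \<Longrightarrow> kind i = kind j"
    and "\<not> (kind h = 1 \<and> kind i = 1 \<and> kind j = 1)"
    and "\<not> (kind h = 2 \<and> kind i = 2 \<and> kind j = 2)"
    using assms(4) by blast+
qed

lemma kind_eq_0_iff: "kind c = 0 \<longleftrightarrow> c \<in> {0, 2, 3}"
  by (simp add: kind_def)

lemma kind_eq_1_iff: "kind c = 1 \<longleftrightarrow> c \<in> {1, 4}"
  by (simp add: kind_def)

lemma kind_le_2: "kind c \<le> 2"
  by (simp add: kind_def)

lemma card_fibres:
  assumes "finite X" "finite K"
  shows "card {z \<in> X. Q z \<and> g z \<in> K} = (\<Sum>k\<in>K. card {z \<in> X. Q z \<and> g z = k})"
proof -
  have "{z \<in> X. Q z \<and> g z \<in> K} = (\<Union>k\<in>K. {z \<in> X. Q z \<and> g z = k})" by auto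
  then show ?thesis
    using assms by (simp, subst card_UN_disjoint) auto
qed

context coloring45 begin

text \<open>The point \<open>z\<close> is itself among the points counted.\<close>

lemma P45_triangle:
  assumes "x \<in> X" "y \<in> X" "z \<in> X"
  shows "P45 (col x y) (col x z) (col z y) \<noteq> 0"
proof -
  have "card {w \<in> X. col x w = col x z \<and> col w y = col z y} \<noteq> 0"
    using assms finite_X by auto
  then show ?thesis using card_col[of x y "col x z" "col z y"] col_le assms by simp
qed

text \<open>This makes kind 0 an equivalence and the kind of a pair dependent only on the blocks of
  its points.\<close>

lemma kind_trans:
  assumes "x \<in> X" "y \<in> X" "z \<in> X" "kind (col x y) = 0"
  shows "kind (col x z) = kind (col z y)"
  using kind_P45(1)[OF _ _ _ P45_triangle[OF assms(1-3)]] assms col_le by blast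

lemma kind_not_mono:
  assumes "x \<in> X" "y \<in> X" "z \<in> X" "kind (col x y) = kind (col x z)" "kind (col y z) = kind (col x y)"
  shows "kind (col x y) = 0"
  using kind_P45(2,3)[OF _ _ _ P45_triangle[OF assms(1-3)]] assms col_le col_sym[of y z]
    kind_le_2[of "col x y"]
  by (metis One_nat_def le_SucE le_zero_eq numeral_2_eq_2)

lemma card_valency:
  assumes "x \<in> X" "i \<le> 5"
  shows "card {z \<in> X. col x z = i} = P45 0 i i"
proof -
  have "{z \<in> X. col x z = i} = {z \<in> X. col x z = i \<and> col z x = i}"
    using col_sym assms by auto
  then show ?thesis using card_col[of x x i i] assms col_eq_0_iff[of x x] by simp
qed

lemma card_X: "card X = 45"
proof -
  obtain x where x: "x \<in> X" using X_nonempty by blast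
  have "X = {z \<in> X. True \<and> col x z \<in> {0, 1, 2, 3, 4, 5}}"
    using col_le[OF x] by (simp add: le5_cases set_eq_iff) blast
  then have "card X = card {z \<in> X. True \<and> col x z \<in> {0, 1, 2, 3, 4, 5}}"
    by (rule arg_cong)
  also have "\<dots> = (\<Sum>i\<in>{0, 1, 2, 3, 4, 5}. card {z \<in> X. True \<and> col x z = i})"
    using finite_X by (intro card_fibres) auto
  also have "\<dots> = 45"
    using card_valency[OF x] by (simp add: scheme45_matrices_def)
  finally show ?thesis .
qed

lemma ex_pentagon:
  "\<exists>v :: 5 \<Rightarrow> 'a. \<forall>i. v i \<in> X \<and> kind (col (v i) (v (i + 1))) = 1 \<and> kind (col (v i) (v (i + 2))) = 2"
proof -
  obtain v0 where v0: "v0 \<in> X" using X_nonempty by blast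
  have [simp]: "col v0 v0 = 0" using col_eq_0_iff v0 by blast
  obtain v1 where v1: "v1 \<in> X" "col v0 v1 = 1"
    using card_nonzero_imp_ex[of v0 v0 1 1] v0 by (auto simp: scheme45_matrices_def)
  obtain v2 where v2: "v2 \<in> X" "col v0 v2 = 5" "col v2 v1 = 1"
    using card_nonzero_imp_ex[of v0 v1 5 1] v0 v1 by (auto simp: scheme45_matrices_def)
  obtain v3 where v3: "v3 \<in> X" "col v0 v3 = 5" "col v3 v2 = 1"
    using card_nonzero_imp_ex[of v0 v2 5 1] v0 v2 by (auto simp: scheme45_matrices_def)
  obtain v4 where v4: "v4 \<in> X" "col v0 v4 = 1" "col v4 v2 = 5"
    using card_nonzero_imp_ex[of v0 v2 1 5] v0 v2 by (auto simp: scheme45_matrices_def)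
  note V = v0 v1(1) v2(1) v3(1) v4(1)
  have sym: "col v1 v0 = 1" "col v2 v0 = 5" "col v1 v2 = 1" "col v3 v0 = 5" "col v2 v3 = 1"
    "col v4 v0 = 1" "col v2 v4 = 5" "col v4 v1 = col v1 v4" "col v3 v1 = col v1 v3"
    "col v4 v3 = col v3 v4"
    using v1 v2 v3 v4 col_sym V by auto
  have k: "kind 1 = 1" "kind (Suc 0) = 1" "kind 4 = 1" "kind 5 = 2" by (simp_all add: kind_def)
  have k012: "kind c = 0 \<or> kind c = 1 \<or> kind c = 2" for c by (simp add: kind_def)
  \<comment> \<open>The three remaining pairs are forced: kind 0 is excluded by a third point seeing
    the two with different kinds, and one of the other kinds by a triangle of a single kind.\<close>
  have "kind (col v1 v3) = 2"
    using kind_trans[of v1 v3 v0] kind_not_mono[of v1 v3 v2] k012[of "col v1 v3"] V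
    by (auto simp: sym v1 v2 v3 v4 k)
  moreover have "kind (col v1 v4) = 2"
    using kind_trans[of v1 v4 v2] kind_not_mono[of v1 v4 v0] k012[of "col v1 v4"] V
    by (auto simp: sym v1 v2 v3 v4 k)
  moreover have "kind (col v3 v4) = 1"
    using kind_trans[of v3 v4 v0] kind_not_mono[of v3 v4 v1] k012[of "col v3 v4"] V
      \<open>kind (col v1 v3) = 2\<close> \<open>kind (col v1 v4) = 2\<close>
    by (auto simp: sym v1 v2 v3 v4 k)
  moreover define v :: "5 \<Rightarrow> 'a" where
    "v i = (if i = 0 then v0 else if i = 1 then v1 else if i = 2 then v2 else if i = 3 then v3 else v4)" for i
  ultimately have "v i \<in> X \<and> kind (col (v i) (v (i + 1))) = 1 \<and> kind (col (v i) (v (i + 2))) = 2" for i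
    using exhaust_mod5[of i] V by (elim disjE) (simp_all add: v_def sym v1 v2 v3 v4 k)
  then show ?thesis by blast
qed

end

locale blocked45 = coloring45 +
  fixes blk :: "'a \<Rightarrow> 5"
  assumes surj_blk: "\<And>i. \<exists>x\<in>X. blk x = i"
    and kind_col: "\<And>x y. x \<in> X \<Longrightarrow> y \<in> X \<Longrightarrow> kind (col x y) =
      (if blk x = blk y then 0 else if blk y = blk x + 1 \<or> blk x = blk y + 1 then 1 else 2)"

lemma (in coloring45) ex_blocked45: "\<exists>blk. blocked45 X col blk"
proof -
  obtain v :: "5 \<Rightarrow> 'a" where vX: "\<And>i. v i \<in> X" and v1: "\<And>i. kind (col (v i) (v (i + 1))) = 1"
    and v2: "\<And>i. kind (col (v i) (v (i + 2))) = 2"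
    using ex_pentagon by blast
  have kv: "kind (col (v i) (v j)) =
      (if i = j then 0 else if j = i + 1 \<or> i = j + 1 then 1 else 2)" for i j
  proof -
    have "j - i = 0 \<or> j - i = 1 \<or> j - i = 2 \<or> j - i = 3 \<or> j - i = 4" by (rule exhaust_mod5)
    \<comment> \<open>Differences 3 and 4 become steps backwards, which symmetry of
      \<open>col\<close> reduces to steps forwards.\<close>
    moreover have "(3 :: 5) = - 2" "(4 :: 5) = - 1" by simp_all
    ultimately consider "j = i" | "j = i + 1" | "j = i + 2" | "i = j + 2" | "i = j + 1"
      by (auto simp: algebra_simps)
    then show ?thesis
    proof cases
      case 1
      then show ?thesis using col_eq_0_iff[of "v i" "v i"] vX by (simp add: kind_def)
    next
      case 2
      then show ?thesis using v1[of i] by simp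
    next
      case 3
      have "i + 2 \<noteq> i + 1" "i \<noteq> i + 2 + 1" by simp_all
      with 3 show ?thesis using v2[of i] by auto
    next
      case 4
      have "j + 2 \<noteq> j + 1" "j \<noteq> j + 2 + 1" by simp_all
      with 4 show ?thesis using v2[of j] col_sym[OF vX[of i] vX[of j]] by auto
    next
      case 5
      then show ?thesis using v1[of j] col_sym[OF vX[of i] vX[of j]] by simp
    qed
  qed
  \<comment> \<open>There is no sixth block: together with the pentagon it would give a
    two-colouring of the edges of the complete graph on six vertices without a monochromatic
    triangle, against the Ramsey number R(3,3) = 6.\<close>
  have "\<exists>i. kind (col x (v i)) = 0" if x: "x \<in> X" for x
  proof (rule ccontr)
    assume "\<not> ?thesis"
    then have ne: "kind (col x (v i)) = 1 \<or> kind (col x (v i)) = 2" for i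
      by (metis kind_def)
    have [simp]: "(5 :: 5) = 0" "(6 :: 5) = 1" by simp_all
    have "\<not> (kind (col x (v i)) = 1 \<and> kind (col x (v (i + 1))) = 1)" for i
      using kind_not_mono[OF x vX vX, of i "i + 1"] v1[of i] by (metis zero_neq_one)
    from this[of 0] this[of 1] this[of 2] this[of 3] this[of 4]
    have one: "\<not> (kind (col x (v 0)) = 1 \<and> kind (col x (v 1)) = 1)"
      "\<not> (kind (col x (v 1)) = 1 \<and> kind (col x (v 2)) = 1)"
      "\<not> (kind (col x (v 2)) = 1 \<and> kind (col x (v 3)) = 1)"
      "\<not> (kind (col x (v 3)) = 1 \<and> kind (col x (v 4)) = 1)"
      "\<not> (kind (col x (v 4)) = 1 \<and> kind (col x (v 0)) = 1)" by simp_all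
    have "\<not> (kind (col x (v i)) = 2 \<and> kind (col x (v (i + 2))) = 2)" for i
      using kind_not_mono[OF x vX vX, of i "i + 2"] v2[of i] by (metis zero_neq_numeral)
    from this[of 0] this[of 1] this[of 2] this[of 3] this[of 4]
    have two: "\<not> (kind (col x (v 0)) = 2 \<and> kind (col x (v 2)) = 2)"
      "\<not> (kind (col x (v 1)) = 2 \<and> kind (col x (v 3)) = 2)"
      "\<not> (kind (col x (v 2)) = 2 \<and> kind (col x (v 4)) = 2)"
      "\<not> (kind (col x (v 3)) = 2 \<and> kind (col x (v 0)) = 2)"
      "\<not> (kind (col x (v 4)) = 2 \<and> kind (col x (v 1)) = 2)" by simp_all
    show False
      using one two ne[of 0] ne[of 1] ne[of 2] ne[of 3] ne[of 4] by argo
  qed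
  then obtain blk where blk: "\<And>x. x \<in> X \<Longrightarrow> kind (col x (v (blk x))) = 0" by metis
  have "blocked45 X col blk"
  proof
    fix i
    have "blk (v i) = i" using blk[OF vX, of i] kv[of i "blk (v i)"] by (auto split: if_splits)
    then show "\<exists>x\<in>X. blk x = i" using vX by blast
  next
    fix x y assume x: "x \<in> X" and y: "y \<in> X"
    have "kind (col x y) = kind (col y (v (blk x)))" using kind_trans[OF x vX y blk[OF x]] .
    also have "\<dots> = kind (col (v (blk x)) (v (blk y)))" using kind_trans[OF y vX vX blk[OF y]] .
    finally show "kind (col x y) =
      (if blk x = blk y then 0 else if blk y = blk x + 1 \<or> blk x = blk y + 1 then 1 else 2)"
      using kv by simp
  qed
  then show ?thesis by blast
qed

section \<open>Neighbourhoods of colour 1 in adjacent blocks\<close>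

context blocked45 begin

definition nbrs :: "5 \<Rightarrow> 'a \<Rightarrow> 'a set" where
  "nbrs j x = {z \<in> X. col x z = 1 \<and> blk z = j}"

lemma blk_eq_iff: "x \<in> X \<Longrightarrow> y \<in> X \<Longrightarrow> blk x = blk y \<longleftrightarrow> col x y \<in> {0, 2, 3}"
  unfolding kind_eq_0_iff[symmetric] by (simp add: kind_col)

lemma card_block: "card {z \<in> X. blk z = i} = 9"
proof -
  obtain x where x: "x \<in> X" "blk x = i" using surj_blk by blast
  have "card {z \<in> X. blk z = i} = card {z \<in> X. True \<and> col x z \<in> {0, 2, 3}}"
    using blk_eq_iff[OF x(1)] x(2) by (intro arg_cong[where f = card] Collect_cong) metis
  also have "\<dots> = (\<Sum>k\<in>{0, 2, 3}. card {z \<in> X. True \<and> col x z = k})"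
    using finite_X by (intro card_fibres) auto
  also have "\<dots> = 9" using card_valency[OF x(1)] by (simp add: scheme45_matrices_def)
  finally show ?thesis .
qed

text \<open>Membership in block \<open>j\<close> is read off from the colour towards one fixed point
  \<open>y\<close> of it. The count is then 1 + 2 + 0 or 0 + 1 + 2, according as
  \<open>col x y\<close> is 1 or 4.\<close>

lemma card_nbrs:
  assumes "x \<in> X" "j = blk x + 1 \<or> blk x = j + 1"
  shows "card (nbrs j x) = 3"
proof -
  obtain y where y: "y \<in> X" "blk y = j" using surj_blk by blast
  have "blk x \<noteq> blk y" using assms(2) unfolding y(2)[symmetric] by (elim disjE) simp_all
  then have "kind (col x y) = 1" using kind_col[OF assms(1) y(1)] assms(2) y(2) by simp
  then have c: "col x y \<in> {1, 4}" unfolding kind_eq_1_iff .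
  have "blk z = j \<longleftrightarrow> col z y \<in> {0, 2, 3}" if "z \<in> X" for z
    using blk_eq_iff[OF that y(1)] y(2) by simp
  then have N: "nbrs j x = {z \<in> X. col x z = 1 \<and> col z y \<in> {0, 2, 3}}"
    unfolding nbrs_def by blast
  have "card (nbrs j x) = (\<Sum>k\<in>{0, 2, 3}. card {z \<in> X. col x z = 1 \<and> col z y = k})"
    unfolding N using finite_X by (rule card_fibres) simp
  also have "\<dots> = (\<Sum>k\<in>{0, 2, 3}. P45 (col x y) 1 k)"
    using assms(1) y by (intro sum.cong) (auto simp: card_col)
  also have "\<dots> = 3" using c by (auto simp: scheme45_matrices_def)
  finally show ?thesis .
qed

text \<open>Colour 3 is impossible because \<open>P45 3 1 1\<close> is 0.\<close>

lemma col_nbrs: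
  assumes "x \<in> X" "y \<in> nbrs j x" "z \<in> nbrs j x" "y \<noteq> z"
  shows "col y z = 2"
proof -
  have yz: "y \<in> X" "z \<in> X" "col y x = 1" "col x z = 1" "blk y = blk z"
    using assms col_sym by (auto simp: nbrs_def)
  then have "col y z \<in> {2, 3}" using blk_eq_iff[of y z] col_eq_0_iff[of y z] assms(4) by auto
  moreover have "col y z \<noteq> 3"
    using P45_triangle[of y z x] yz assms(1) by (auto simp: scheme45_matrices_def)
  ultimately show ?thesis by simp
qed

text \<open>Two vertices of the lattice graph \<open>R 2\<close> lie on a unique line, so two elements of \<open>nbrs j x\<close>
  determine the third one.\<close>

lemma nbrs_eqI:
  assumes x: "x \<in> X" "j = blk x + 1 \<or> blk x = j + 1" and "y \<in> nbrs j x" "z \<in> nbrs j x" "y \<noteq> z"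
  shows "nbrs j x = {y, z} \<union> {w \<in> X. col y w = 2 \<and> col w z = 2}"
proof (rule card_seteq)
  have yz: "y \<in> X" "z \<in> X" using assms by (auto simp: nbrs_def)
  show "finite ({y, z} \<union> {w \<in> X. col y w = 2 \<and> col w z = 2})" using finite_X by simp
  show "nbrs j x \<subseteq> {y, z} \<union> {w \<in> X. col y w = 2 \<and> col w z = 2}"
  proof
    fix w assume w: "w \<in> nbrs j x"
    show "w \<in> {y, z} \<union> {w \<in> X. col y w = 2 \<and> col w z = 2}"
      using col_nbrs[OF x(1) assms(3) w] col_nbrs[OF x(1) w assms(4)] w by (auto simp: nbrs_def)
  qed
  have "card {w \<in> X. col y w = 2 \<and> col w z = 2} = 1"
    using card_col[OF yz, of 2 2] col_nbrs[OF x(1) assms(3,4,5)]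
    by (simp add: scheme45_matrices_def)
  then have "card ({y, z} \<union> {w \<in> X. col y w = 2 \<and> col w z = 2}) \<le> 2 + 1"
    using card_Un_le[of "{y, z}"] card_insert_le_m1 \<open>y \<noteq> z\<close> by (metis card_2_iff)
  then show "card ({y, z} \<union> {w \<in> X. col y w = 2 \<and> col w z = 2}) \<le> card (nbrs j x)"
    using card_nbrs[OF x] by simp
qed

lemma finite_nbrs: "finite (nbrs j x)"
  using finite_X by (simp add: nbrs_def)

text \<open>If two points are common to both sets, \<open>nbrs_eqI\<close> gives the same formula
  for each set.\<close>

lemma nbrs_eq_or_card_Int_le_1:
  assumes "x \<in> X" "x' \<in> X" "blk x = blk x'" "j = blk x + 1 \<or> blk x = j + 1"
  shows "nbrs j x = nbrs j x' \<or> card (nbrs j x \<inter> nbrs j x') \<le> 1"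
proof (rule ccontr)
  assume *: "\<not> ?thesis"
  then have "\<not> card (nbrs j x \<inter> nbrs j x') \<le> Suc 0" by simp
  then obtain y z where "y \<in> nbrs j x \<inter> nbrs j x'" "z \<in> nbrs j x \<inter> nbrs j x'" "y \<noteq> z"
    using card_le_Suc0_iff_eq[of "nbrs j x \<inter> nbrs j x'"] finite_nbrs by auto
  then show False
    using nbrs_eqI[of x j y z] nbrs_eqI[of x' j y z] assms * by auto
qed

definition up :: "'a \<Rightarrow> 'a set" where "up x = nbrs (blk x + 1) x"
definition dn :: "'a \<Rightarrow> 'a set" where "dn x = nbrs (blk x - 1) x"

lemma card_up: "x \<in> X \<Longrightarrow> card (up x) = 3" and card_dn: "x \<in> X \<Longrightarrow> card (dn x) = 3"
  using card_nbrs by (simp_all add: up_def dn_def)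

lemma in_up_iff: "y \<in> up x \<longleftrightarrow> y \<in> X \<and> col x y = 1 \<and> blk y = blk x + 1"
  by (auto simp: up_def nbrs_def)

lemma in_dn_iff: "y \<in> dn x \<longleftrightarrow> y \<in> X \<and> col x y = 1 \<and> blk x = blk y + 1"
  by (auto simp: dn_def nbrs_def)

lemma in_up_iff_in_dn: "x \<in> X \<Longrightarrow> y \<in> X \<Longrightarrow> y \<in> up x \<longleftrightarrow> x \<in> dn y"
  by (auto simp: in_up_iff in_dn_iff col_sym)

text \<open>The counts of common neighbours above and below add up to 3 and each of them is 0, 1 or 3.\<close>

lemma col_2_up_dn:
  assumes x: "x \<in> X" "x' \<in> X" and "col x x' = 2"
  shows "up x = up x' \<and> dn x \<inter> dn x' = {} \<or> dn x = dn x' \<and> up x \<inter> up x' = {}"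
proof -
  have b: "blk x = blk x'" using blk_eq_iff x assms(3) by simp
  have adj: "blk z = blk x + 1 \<or> blk x = blk z + 1" if "z \<in> X" "col x z = 1" for z
  proof -
    have "kind (col x z) = 1" using that(2) kind_eq_1_iff by simp
    then show ?thesis using kind_col[OF x(1) that(1)] by (metis zero_neq_one one_eq_numeral_iff num.distinct(1))
  qed
  have "{z \<in> X. col x z = 1 \<and> col z x' = 1} = (up x \<inter> up x') \<union> (dn x \<inter> dn x')"
  proof (rule set_eqI)
    fix z show "z \<in> {z \<in> X. col x z = 1 \<and> col z x' = 1} \<longleftrightarrow> z \<in> (up x \<inter> up x') \<union> (dn x \<inter> dn x')"
      unfolding in_up_iff in_dn_iff Int_iff Un_iff mem_Collect_eq b[symmetric]
      using adj[of z] col_sym[of z x'] x(2) by (cases "z \<in> X") (simp, argo, simp)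
  qed
  moreover have "(up x \<inter> up x') \<inter> (dn x \<inter> dn x') = {}"
  proof -
    have "blk x + 1 + 1 \<noteq> blk x" by simp
    then have "\<not> (z \<in> up x \<and> z \<in> dn x)" for z unfolding in_up_iff in_dn_iff by metis
    then show ?thesis by blast
  qed
  moreover have fin: "finite (up x)" "finite (dn x)" using finite_nbrs by (simp_all add: up_def dn_def)
  ultimately have "card (up x \<inter> up x') + card (dn x \<inter> dn x') = 3"
    using card_col[OF x, of 1 1] assms(3) card_Un_disjoint[of "up x \<inter> up x'" "dn x \<inter> dn x'"]
    by (simp add: scheme45_matrices_def)
  moreover have "up x = up x' \<or> card (up x \<inter> up x') \<le> 1" "dn x = dn x' \<or> card (dn x \<inter> dn x') \<le> 1"
    using nbrs_eq_or_card_Int_le_1[OF x b] b by (simp_all add: up_def dn_def)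
  ultimately show ?thesis
    using card_up[OF x(1)] card_dn[OF x(1)] fin by (elim disjE) auto
qed

lemma col_3_up_dn:
  assumes x: "x \<in> X" "x' \<in> X" and "col x x' = 3"
  shows "up x \<inter> up x' = {}" "dn x \<inter> dn x' = {}"
proof -
  have "\<not> (z \<in> X \<and> col x z = 1 \<and> col x' z = 1)" for z
    using P45_triangle[of x x' z] x assms(3) col_sym[of x' z] by (auto simp: scheme45_matrices_def)
  then show "up x \<inter> up x' = {}" "dn x \<inter> dn x' = {}"
    by (auto simp: in_up_iff in_dn_iff)
qed

lemma up_nonempty: "x \<in> X \<Longrightarrow> up x \<noteq> {}" and dn_nonempty: "x \<in> X \<Longrightarrow> dn x \<noteq> {}"
  using card_up card_dn by fastforce+

text \<open>\<open>dn x\<close> and \<open>up x\<close> act as the two coordinates of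
  \<open>x\<close> in the lattice of its block. Nonemptiness turns the disjointness found for
  colours 2 and 3 into inequality.\<close>

lemma col_within_block:
  assumes x: "x \<in> X" "x' \<in> X" and "blk x = blk x'"
  shows "col x x' = (if dn x = dn x' then if up x = up x' then 0 else 2
    else if up x = up x' then 2 else 3)"
proof -
  have "col x x' \<in> {0, 2, 3}" using blk_eq_iff assms by blast
  then show ?thesis
    using col_2_up_dn[OF x] col_3_up_dn[OF x] col_eq_0_iff[OF x] up_nonempty dn_nonempty x
    by auto
qed

lemma up_eq_or_disjoint:
  assumes "x \<in> X" "x' \<in> X" "blk x = blk x'"
  shows "up x = up x' \<or> up x \<inter> up x' = {}"
    and "dn x = dn x' \<or> dn x \<inter> dn x' = {}"
proof -
  have "col x x' \<in> {0, 2, 3}" using blk_eq_iff assms by blast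
  then show "up x = up x' \<or> up x \<inter> up x' = {}" "dn x = dn x' \<or> dn x \<inter> dn x' = {}"
    using col_2_up_dn[OF assms(1,2)] col_3_up_dn[OF assms(1,2)] col_eq_0_iff[OF assms(1,2)]
    by (elim insertE; simp; blast)+
qed

section \<open>Coordinates from labelled lines\<close>

text \<open>All points of \<open>dn y\<close> have the same \<open>up\<close> set, so the union is
  that one set, obtained without a choice. It lies in the block of \<open>y\<close>, unlike
  \<open>dn y\<close>, and can be compared with the sets \<open>up x\<close> of the preceding
  block.\<close>

definition line :: "'a \<Rightarrow> 'a set" where "line y = \<Union> (up ` dn y)"

lemma line_eq:
  assumes "x \<in> X" "y \<in> up x"
  shows "line y = up x"
proof -
  have y: "y \<in> X" using assms by (simp add: in_up_iff)
  have "up x' = up x" if "x' \<in> dn y" for x'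
  proof -
    have "x' \<in> X" "y \<in> up x'" "blk x' = blk x"
      using that y in_up_iff_in_dn[of x' y] assms by (auto simp: in_dn_iff in_up_iff)
    then show ?thesis using up_eq_or_disjoint(1)[of x' x] assms by blast
  qed
  moreover have "x \<in> dn y" using assms y in_up_iff_in_dn by blast
  ultimately show ?thesis unfolding line_def by blast
qed

lemma line_obtain:
  assumes "y \<in> X"
  obtains x where "x \<in> X" "blk y = blk x + 1" "y \<in> up x" "line y = up x"
proof -
  obtain x where "x \<in> dn y" using dn_nonempty assms by blast
  then have "x \<in> X" "blk y = blk x + 1" "y \<in> up x"
    using assms in_up_iff_in_dn by (auto simp: in_dn_iff)
  then show ?thesis using that line_eq by blast
qed

text \<open>A point \<open>x\<close> with \<open>up x = line y\<close> lies below every point of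
  that line, so equal lines make \<open>dn y\<close> and \<open>dn y'\<close> meet, and sets that
  meet are equal.\<close>

lemma line_eq_iff_dn:
  assumes "y \<in> X" "y' \<in> X" "blk y = blk y'"
  shows "line y = line y' \<longleftrightarrow> dn y = dn y'"
proof
  assume eq: "line y = line y'"
  obtain x where x: "x \<in> X" "blk y = blk x + 1" "y \<in> up x" "line y = up x"
    using line_obtain[OF assms(1)] .
  obtain x' where x': "x' \<in> X" "y' \<in> up x'" "line y' = up x'"
    using line_obtain[OF assms(2)] .
  have "x \<in> dn y" "x \<in> dn y'"
    using x x' eq assms in_up_iff_in_dn by auto
  then show "dn y = dn y'" using up_eq_or_disjoint(2)[OF assms] by blast
qed (simp add: line_def)

lemma col_eq_1_iff:
  assumes "x \<in> X" "y \<in> X" "blk y = blk x + 1"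
  shows "col x y = 1 \<longleftrightarrow> up x = line y"
proof
  assume "col x y = 1"
  then show "up x = line y" using assms line_eq by (simp add: in_up_iff)
next
  assume "up x = line y"
  moreover have "y \<in> line y" using line_obtain[OF assms(2)] by metis
  ultimately show "col x y = 1" by (auto simp: in_up_iff)
qed

lemma col_next_block:
  assumes "x \<in> X" "y \<in> X" "blk y = blk x + 1"
  shows "col x y = (if up x = line y then 1 else 4)"
proof -
  have "kind (col x y) = 1" using kind_col[of x y] assms by simp
  then have "col x y \<in> {1, 4}" unfolding kind_eq_1_iff .
  then show ?thesis using col_eq_1_iff[OF assms] by auto
qed

text \<open>The \<open>up\<close> sets of a block are disjoint triples among the nine points of the
  next block, so there are at most three of them.\<close>

lemma ex_labelling: "\<exists>t :: 'a set \<Rightarrow> 3. inj_on t (up ` {x \<in> X. blk x = i})"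
proof -
  let ?F = "up ` {x \<in> X. blk x = i}"
  have fin: "finite ?F" using finite_X by simp
  have "\<Union> ?F \<subseteq> {z \<in> X. blk z = i + 1}" by (auto simp: in_up_iff)
  then have "card (\<Union> ?F) \<le> 9"
    using card_block[of "i + 1"] card_mono[of "{z \<in> X. blk z = i + 1}"] finite_X by simp
  moreover have "3 * card ?F = card (\<Union> ?F)"
  proof (rule card_partition)
    show "finite (\<Union> ?F)" using finite_X by (auto simp: up_def finite_nbrs)
    show "card c = 3" if "c \<in> ?F" for c using that card_up by auto
    show "c \<inter> c' = {}" if "c \<in> ?F" "c' \<in> ?F" "c \<noteq> c'" for c c'
      using that up_eq_or_disjoint(1) by auto
  qed (rule fin)
  ultimately have "card ?F \<le> card (UNIV :: 3 set)" by simp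
  then show ?thesis
    using inj_on_iff_card_le[OF fin, of "UNIV :: 3 set"] by auto
qed

lemma ex_bij_shape: "\<exists>\<phi>. bij_betw \<phi> X UNIV \<and> (\<forall>x\<in>X. \<forall>y\<in>X. shape (\<phi> x) (\<phi> y) = col x y)"
proof -
  have "\<exists>t :: 5 \<Rightarrow> 'a set \<Rightarrow> 3. \<forall>i. inj_on (t i) (up ` {x \<in> X. blk x = i})"
    using ex_labelling by (intro choice allI)
  then obtain t :: "5 \<Rightarrow> 'a set \<Rightarrow> 3" where t: "\<And>i. inj_on (t i) (up ` {x \<in> X. blk x = i})"
    by blast
  \<comment> \<open>\<open>t i\<close> labels the lines matched between blocks \<open>i\<close> and
    \<open>i + 1\<close>. The first coordinate in the block therefore uses the labelling of the
    preceding block and the second its own, and matched lines receive the same label.\<close>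
  define \<phi> where "\<phi> x = (blk x, t (blk x - 1) (line x), t (blk x) (up x))" for x
  have line_in: "line y \<in> up ` {x \<in> X. blk x = blk y - 1}" if "y \<in> X" for y
    using line_obtain[OF that] by (metis (mono_tags, lifting) add_diff_cancel_right' image_eqI mem_Collect_eq)
  have t_up: "t (blk x) (up x) = t (blk x) (up y) \<longleftrightarrow> up x = up y" if "x \<in> X" "y \<in> X" "blk x = blk y" for x y
    using that by (intro inj_on_eq_iff[OF t[of "blk x"]]) auto
  have t_line: "t (blk x - 1) (line x) = t (blk x - 1) (line y) \<longleftrightarrow> line x = line y"
    if "x \<in> X" "y \<in> X" "blk x = blk y" for x y
    using that line_in[of x] line_in[of y] by (intro inj_on_eq_iff[OF t[of "blk x - 1"]]) auto
  have t_up_line: "t (blk x) (up x) = t (blk x) (line y) \<longleftrightarrow> up x = line y"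
    if "x \<in> X" "y \<in> X" "blk y = blk x + 1" for x y
    using that line_in[of y] by (intro inj_on_eq_iff[OF t[of "blk x"]]) auto
  have shape: "shape (\<phi> x) (\<phi> y) = col x y" if xy: "x \<in> X" "y \<in> X" for x y
  proof -
    consider "blk x = blk y" | "blk y = blk x + 1" | "blk x = blk y + 1"
      | "blk x \<noteq> blk y" "blk y \<noteq> blk x + 1" "blk x \<noteq> blk y + 1" by blast
    then show ?thesis
    proof cases
      case 1
      then show ?thesis
        using col_within_block[OF xy 1] t_up[OF xy 1] t_line[OF xy 1] line_eq_iff_dn[OF xy 1]
        by (simp add: shape_def \<phi>_def)
    next
      case 2
      then show ?thesis
        using col_next_block[OF xy 2] t_up_line[OF xy 2] by (simp add: shape_def \<phi>_def)
    next
      case 3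
      have "blk y + 1 + 1 \<noteq> blk y" by simp
      with 3 show ?thesis
        using col_next_block[OF xy(2,1) 3] t_up_line[OF xy(2,1) 3] col_sym[OF xy]
        by (auto simp: shape_def \<phi>_def)
    next
      case 4
      then have "kind (col x y) = 2" using kind_col[OF xy] by simp
      then have "col x y \<notin> {0, 1, 2, 3, 4}" by (auto simp: kind_def split: if_splits)
      then have "col x y = 5" using col_le[OF xy] by auto
      with 4 show ?thesis by (simp add: shape_def \<phi>_def)
    qed
  qed
  \<comment> \<open>Preserving colours gives injectivity, as colour 0 is equality; surjectivity
    follows from 45 = 5 * 3 * 3.\<close>
  have inj: "inj_on \<phi> X"
  proof (rule inj_onI)
    fix x y assume *: "x \<in> X" "y \<in> X" "\<phi> x = \<phi> y"
    then have "col x y = col x x" using shape[of x y] shape[of x x] by simp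
    then show "x = y" using col_eq_0_iff * by metis
  qed
  have "card (\<phi> ` X) = card (UNIV :: (5 \<times> 3 \<times> 3) set)"
    using card_image[OF inj] card_X by (simp add: card_UNIV_def)
  then have "\<phi> ` X = UNIV" by (intro card_subset_eq) auto
  with inj shape show ?thesis unfolding bij_betw_def by blast
qed

end

section \<open>Isomorphism of any two schemes, and existence\<close>

lemma scheme45_inj_on:
  assumes "scheme45 X R"
  shows "inj_on R {0..5}"
proof (rule inj_onI)
  fix i j :: nat assume ij: "i \<in> {0..5}" "j \<in> {0..5}" "R i = R j"
  have "R i \<noteq> {}" "disjoint_family_on R {0..5}"
    using assms ij by (auto simp: scheme45_def symmetric_association_scheme_def)
  then show "i = j" using ij unfolding disjoint_family_on_def by (metis Int_absorb)
qed

lemma scheme45_ex_bij_shape: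
  assumes "scheme45 X R"
  shows "\<exists>\<phi>. bij_betw \<phi> X UNIV \<and>
    (\<forall>x\<in>X. \<forall>y\<in>X. \<forall>i\<in>{0..5}. (x, y) \<in> R i \<longleftrightarrow> shape (\<phi> x) (\<phi> y) = i)"
proof -
  obtain col where col: "coloring45 X col" and R: "\<And>i. i \<le> 5 \<Longrightarrow> R i = color_rel X col i"
    using scheme45_obtain_coloring[OF assms] by blast
  obtain blk where blk: "blocked45 X col blk" using coloring45.ex_blocked45[OF col] ..
  obtain \<phi> where "bij_betw \<phi> X UNIV" "\<forall>x\<in>X. \<forall>y\<in>X. shape (\<phi> x) (\<phi> y) = col x y"
    using blocked45.ex_bij_shape[OF blk] by blast
  with R show ?thesis by (intro exI[of _ \<phi>]) (simp add: color_rel_def)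
qed

lemma scheme45_isomorphic:
  assumes "scheme45 X R" "scheme45 X' R'"
  shows "isomorphic_schemes X (R ` {0..5}) X' (R' ` {0..5})"
proof -
  obtain \<phi> where \<phi>: "bij_betw \<phi> X UNIV"
    "\<forall>x\<in>X. \<forall>y\<in>X. \<forall>i\<in>{0..5}. (x, y) \<in> R i \<longleftrightarrow> shape (\<phi> x) (\<phi> y) = i"
    using scheme45_ex_bij_shape[OF assms(1)] by blast
  obtain \<phi>' where \<phi>': "bij_betw \<phi>' X' UNIV"
    "\<forall>x\<in>X'. \<forall>y\<in>X'. \<forall>i\<in>{0..5}. (x, y) \<in> R' i \<longleftrightarrow> shape (\<phi>' x) (\<phi>' y) = i"
    using scheme45_ex_bij_shape[OF assms(2)] by blast
  define f where "f = inv_into X' \<phi>' \<circ> \<phi>"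
  \<comment> \<open>\<open>R i\<close> is sent to \<open>R' i\<close>; the index can be recovered
    from the relation because \<open>R\<close> is injective on the indices.\<close>
  define \<psi> where "\<psi> = R' \<circ> inv_into {0..5} R"
  have f: "bij_betw f X X'"
    unfolding f_def by (rule bij_betw_trans[OF \<phi>(1) bij_betw_inv_into[OF \<phi>'(1)]])
  have \<psi>: "bij_betw \<psi> (R ` {0..5}) (R' ` {0..5})"
    unfolding \<psi>_def
    by (rule bij_betw_trans[OF bij_betw_inv_into])
      (simp_all add: scheme45_inj_on[OF assms(1)] scheme45_inj_on[OF assms(2)] inj_on_imp_bij_betw)
  have \<psi>_R: "\<psi> (R i) = R' i" if "i \<in> {0..5}" for i
    using inv_into_f_f[OF scheme45_inj_on[OF assms(1)] that] by (simp add: \<psi>_def)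
  \<comment> \<open>This holds even outside \<open>X\<close>, since \<open>\<phi>'\<close> maps
    \<open>X'\<close> onto the whole type.\<close>
  have \<phi>'_f: "\<phi>' (f x) = \<phi> x" for x
    using bij_betw_inv_into_right[OF \<phi>'(1)] by (simp add: f_def)
  have "(x, y) \<in> R i \<longleftrightarrow> (f x, f y) \<in> \<psi> (R i)" if "x \<in> X" "y \<in> X" "i \<in> {0..5}" for x y i
  proof -
    have "f x \<in> X'" "f y \<in> X'" using f that by (auto dest: bij_betwE)
    then have "(f x, f y) \<in> R' i \<longleftrightarrow> shape (\<phi> x) (\<phi> y) = i"
      using \<phi>'(2) that(3) by (simp add: \<phi>'_f)
    then show ?thesis using \<phi>(2) that \<psi>_R by simp
  qed
  with f \<psi> show ?thesis unfolding isomorphic_schemes_def by blast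
qed

theorem theorem6p2:
  "(\<exists>(X :: nat set) R. scheme45 X R) \<and>
   (\<forall>(X :: 'a set) R (X' :: 'b set) R'.
      scheme45 X R \<longrightarrow> scheme45 X' R' \<longrightarrow>
      isomorphic_schemes X (R ` {0..5}) X' (R' ` {0..5}))"
proof
  show "\<exists>(X :: nat set) R. scheme45 X R"
    \<comment> \<open>The witness is the image of the model under the injection
      \<open>to_nat\<close>.\<close>
    using coloring45.scheme45_color_rel[OF coloring45.coloring45_image[OF coloring45_shape inj_to_nat]]
    by blast
  show "\<forall>(X :: 'a set) R (X' :: 'b set) R'. scheme45 X R \<longrightarrow> scheme45 X' R' \<longrightarrow>
      isomorphic_schemes X (R ` {0..5}) X' (R' ` {0..5})"
    using scheme45_isomorphic by blast
qed

end
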